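(* The commutator subgroup $\widehat{[M,G_{+}]_{\odot}}$, defined as the subgroup of $(G,\odot)$ generated by the set of commutators $$[M,G_+]_\odot=\{\mathbf{x}\odot\mathbf{y}\odot\mathbf{x}^{\odot-1}\odot\mathbf{y}^{\odot-1}:\ \mathbf{x}\in M,\ \mathbf{y}\in G_+\},$$ is a normal subgroup of $G_{+}$.
   Context: Let $X=\{x_0,x_1\}$ be an alphabet of two non-commuting letters, $X^*$ the set of words in $X$ (including the empty word, written $\emptyset$ or $\mathbf{1}$), and $\mathbb{R}\langle\langle X\rangle\rangle$ the space of formal power series $c=\sum_{\eta\in X^*}c(\eta)\eta$ with $c(\eta)\in\mathbb{R}$. The symbol $\sqcup\!\sqcup$ denotes the usual shuffle product on $\mathbb{R}\langle\langle X\rangle\rangle$ (dual to the coproduct for which the letters are primitive), with unit $\emptyset$, also written $1$; $c(\mathbf 1)$ is the constant coefficient of $c$. Let $G=\{\mathbf{c}=[c_1\;\;c_2]^t\in\mathbb{R}\langle\langle X\rangle\rangle^2: c_1(\mathbf{1})=1\}$ with the product $$\mathbf{c}\odot\mathbf{d}=[\,c_1\sqcup\!\sqcup d_1\;\;\;c_2+(d_2\sqcup\!\sqcup c_1)\,]^t .$$ It is known that $(G,\odot)$ is a group with identity $\mathbf{e}=[1\;\;0]^t$; the inverse of $\mathbf{c}$ is written $\mathbf{c}^{\odot-1}$. As subgroups of $(G,\odot)$: $M$ denotes the (embedded) shuffle group $\{[c\;\;0]^t: c\in\mathbb{R}\langle\langle X\rangle\rangle,\ c(\mathbf{1})=1\}$,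 and $G_+$ denotes the (embedded) additive group $\{[1\;\;d]^t: d\in\mathbb{R}\langle\langle X\rangle\rangle\}$. *)

theory Defs
  imports Complex_Main "HOL-Algebra.Coset" "HOL-Algebra.Generated_Groups"
begin

datatype letter = X0 | X1

type_synonym word = "letter list"

text \<open>A formal power series is identified with its coefficient function.\<close>

type_synonym series = "word \<Rightarrow> real"

definition series_one :: series where
  "series_one = (\<lambda>w. if w = [] then 1 else 0)"

definition series_zero :: series where
  "series_zero = (\<lambda>w. 0)"

definition series_add :: "series \<Rightarrow> series \<Rightarrow> series" where
  "series_add c d = (\<lambda>w. c w + d w)"

text \<open>
  The coproduct on words that is multiplicative for concatenation and for which every letter is
  primitive, that is, \<open>\<Delta>(x w) = (x \<otimes> 1 + 1 \<otimes> x) \<Delta>(w)\<close>. The list enumerates the summands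
  \<open>u \<otimes> v\<close> with multiplicity.
\<close>

fun coproduct :: "word \<Rightarrow> (word \<times> word) list" where
  "coproduct [] = [([], [])]"
| "coproduct (x # w) =
     map (\<lambda>(u, v). (x # u, v)) (coproduct w) @ map (\<lambda>(u, v). (u, x # v)) (coproduct w)"

definition shuffle :: "series \<Rightarrow> series \<Rightarrow> series" where
  "shuffle c d = (\<lambda>w. \<Sum>(u, v)\<leftarrow>coproduct w. c u * d v)"

text \<open>
  On words, this product satisfies the familiar recursion
  \<open>xu \<squnion> yv = x (u \<squnion> yv) + y (xu \<squnion> v)\<close>.
\<close>

definition word_series :: "word \<Rightarrow> series" where
  "word_series u = (\<lambda>w. if w = u then 1 else 0)"

definition letter_times :: "letter \<Rightarrow> series \<Rightarrow> series" where
  "letter_times x c = (\<lambda>w. case w of [] \<Rightarrow> 0 | y # v \<Rightarrow> if y = x then c v else 0)"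

lemma shuffle_Nil: "shuffle c d [] = c [] * d []"
  by (simp add: shuffle_def)

lemma shuffle_Cons:
  "shuffle c d (x # w) = shuffle (\<lambda>u. c (x # u)) d w + shuffle c (\<lambda>v. d (x # v)) w"
  by (simp add: shuffle_def case_prod_unfold comp_def)

lemma shuffle_zero_left: "shuffle (\<lambda>u. 0) d w = 0"
  by (induction w arbitrary: d) (simp_all add: shuffle_Nil shuffle_Cons)

lemma shuffle_zero_right: "shuffle c (\<lambda>u. 0) w = 0"
  by (induction w arbitrary: c) (simp_all add: shuffle_Nil shuffle_Cons)

lemma shuffle_one_left: "shuffle series_one d = d"
proof
  fix w show "shuffle series_one d w = d w"
    by (induction w arbitrary: d)
      (simp_all add: shuffle_Nil shuffle_Cons shuffle_zero_left series_one_def[abs_def])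
qed

lemma shuffle_one_right: "shuffle c series_one = c"
proof
  fix w show "shuffle c series_one w = c w"
    by (induction w arbitrary: c)
      (simp_all add: shuffle_Nil shuffle_Cons shuffle_zero_right series_one_def[abs_def])
qed

lemma shuffle_word_series_Cons:
  "shuffle (word_series (x # u)) (word_series (y # v)) =
     series_add (letter_times x (shuffle (word_series u) (word_series (y # v))))
                (letter_times y (shuffle (word_series (x # u)) (word_series v)))"
proof
  fix w
  have *: "(\<lambda>t. word_series (a # s) (b # t)) = (if b = a then word_series s else (\<lambda>t. 0))"
    for a b s by (auto simp: word_series_def)
  have **: "word_series (a # s) [] = 0" for a s by (simp add: word_series_def)
  show "shuffle (word_series (x # u)) (word_series (y # v)) w =
     series_add (letter_times x (shuffle (word_series u) (word_series (y # v))))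
                (letter_times y (shuffle (word_series (x # u)) (word_series v))) w"
    by (cases w) (auto simp: shuffle_Nil shuffle_Cons series_add_def letter_times_def *
        shuffle_zero_left shuffle_zero_right **)
qed

definition G :: "(series \<times> series) monoid" where
  "G = \<lparr>carrier = {(c1, c2). c1 [] = 1},
        mult = (\<lambda>(c1, c2) (d1, d2). (shuffle c1 d1, series_add c2 (shuffle d2 c1))),
        one = (series_one, series_zero)\<rparr>"

definition M :: "(series \<times> series) set" where
  "M = {(c, series_zero) | c. c [] = 1}"

definition G_plus :: "(series \<times> series) set" where
  "G_plus = {(series_one, d) | d. True}"

definition commutators :: "(series \<times> series) set" where
  "commutators = {x \<otimes>\<^bsub>G\<^esub> y \<otimes>\<^bsub>G\<^esub> inv\<^bsub>G\<^esub> x \<otimes>\<^bsub>G\<^esub> inv\<^bsub>G\<^esub> y | x y. x \<in> M \<and> y \<in> G_plus}"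

end

theory Submission
  imports Defs
begin

text \<open>
  For \<open>x = (c, 0)\<close> in \<^const>\<open>M\<close> and \<open>y = (1, d)\<close> in \<^const>\<open>G_plus\<close> the first component of
  the product of \<open>x\<close>, \<open>y\<close>, \<open>x\<inverse>\<close> and \<open>y\<inverse>\<close> is \<open>1\<close>, because the first components multiply by
  the commutative shuffle product and that of \<open>y\<close> is \<open>1\<close>. Hence every commutator lies in
  \<^const>\<open>G_plus\<close> (lemma \<open>commutators_subset\<close>), and so does the subgroup that they generate. On
  \<^const>\<open>G_plus\<close> the product is addition of the second components, so \<^const>\<open>G_plus\<close> is
  abelian, and each of its subgroups is normal.

  The inverses involved make sense because \<^const>\<open>G\<close> is a group (lemma \<open>group_G\<close>). This rests on
  the shuffle algebra being commutative and associative, and on the existence of a shuffle inverse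
  of every series \<open>c\<close> with constant coefficient \<open>1\<close> (lemma \<open>shuffle_inverse_exists\<close>). The inverse
  is the geometric series in \<open>1 - c\<close>, which is locally finite since the \<open>n\<close>-th shuffle power of
  \<open>1 - c\<close> vanishes on all words shorter than \<open>n\<close>.
\<close>

lemma shuffle_add_left:
  "shuffle (\<lambda>u. a u + b u) c w = shuffle a c w + shuffle b c w"
  by (induction w arbitrary: a b c) (simp_all add: shuffle_Nil shuffle_Cons algebra_simps)

lemma shuffle_commute: "shuffle c d = shuffle d c"
proof
  fix w show "shuffle c d w = shuffle d c w"
    by (induction w arbitrary: c d) (simp_all add: shuffle_Nil shuffle_Cons)
qed

lemma shuffle_add_right:
  "shuffle c (\<lambda>u. a u + b u) w = shuffle c a w + shuffle c b w"
  by (simp add: shuffle_commute[of c] shuffle_add_left)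

lemma shuffle_minus_left: "shuffle (\<lambda>u. - a u) c w = - shuffle a c w"
  using shuffle_add_left[of a "\<lambda>u. - a u" c w] by (simp add: shuffle_zero_left)

lemma shuffle_diff_left:
  "shuffle (\<lambda>u. a u - b u) c w = shuffle a c w - shuffle b c w"
  using shuffle_add_left[of a "\<lambda>u. - b u" c w] by (simp add: shuffle_minus_left)

lemma shuffle_sum_right:
  "finite I \<Longrightarrow> shuffle c (\<lambda>u. \<Sum>i\<in>I. f i u) w = (\<Sum>i\<in>I. shuffle c (f i) w)"
  by (induction I rule: finite_induct) (simp_all add: shuffle_zero_right shuffle_add_right)

lemma shuffle_assoc: "shuffle (shuffle a b) c = shuffle a (shuffle b c)"
proof
  fix w show "shuffle (shuffle a b) c w = shuffle a (shuffle b c) w"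
    by (induction w arbitrary: a b c)
      (simp_all add: shuffle_Nil shuffle_Cons shuffle_add_left shuffle_add_right)
qed

lemma length_coproduct:
  "(u, v) \<in> set (coproduct w) \<Longrightarrow> length u + length v = length w"
  by (induction w arbitrary: u v) auto

lemma shuffle_cong_right:
  assumes "\<And>v. length v \<le> length w \<Longrightarrow> d v = d' v"
  shows "shuffle c d w = shuffle c d' w"
proof -
  have "c u * d v = c u * d' v" if "(u, v) \<in> set (coproduct w)" for u v
    using assms[of v] length_coproduct[OF that] by simp
  then show ?thesis
    unfolding shuffle_def by (intro arg_cong[where f = sum_list] map_cong) auto
qed

lemma shuffle_vanishes:
  fixes p d :: series
  assumes "p [] = 0" and "\<And>v. length v < n \<Longrightarrow> d v = 0" and "length w < Suc n"
  shows "shuffle p d w = 0"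
proof -
  have "p u * d v = 0" if "(u, v) \<in> set (coproduct w)" for u v
    using assms length_coproduct[OF that] by (cases u) auto
  then have "shuffle p d w = (\<Sum>_\<leftarrow>coproduct w. 0)"
    unfolding shuffle_def by (intro arg_cong[where f = sum_list] map_cong) auto
  then show ?thesis by simp
qed

lemma shuffle_power_vanishes:
  fixes p :: series
  assumes "p [] = 0" and "length w < n"
  shows "(shuffle p ^^ n) series_one w = 0"
  using assms(2)
proof (induction n arbitrary: w)
  case (Suc n)
  then show ?case using shuffle_vanishes[of p n "(shuffle p ^^ n) series_one" w] assms(1) by simp
qed simp

lemma shuffle_inverse_exists:
  assumes "c [] = 1"
  shows "\<exists>d. d [] = 1 \<and> shuffle d c = series_one"
proof -
  define p where "p = (\<lambda>u. series_one u - c u)"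
  define q where "q n = (shuffle p ^^ n) series_one" for n
  define d where "d = (\<lambda>w. \<Sum>n\<le>length w. q n w)"
  have p0: "p [] = 0"
    using assms by (simp add: p_def series_one_def)
  have c: "c = (\<lambda>u. series_one u - p u)"
    by (simp add: p_def)
  have q_vanishes: "q n w = 0" if "length w < n" for n w
    using shuffle_power_vanishes[of p w n] p0 that by (simp add: q_def)
  \<comment> \<open>On words of length at most \<open>N\<close> the series \<open>d\<close> agrees with its \<open>N\<close>-th partial sum.\<close>
  have d: "d v = (\<Sum>n\<le>N. q n v)" if "length v \<le> N" for v N
    unfolding d_def using that q_vanishes by (intro sum.mono_neutral_left) auto
  have "shuffle c d w = series_one w" for w
  proof -
    have "shuffle c d w = shuffle c (\<lambda>v. \<Sum>n\<le>length w. q n v) w"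
      by (rule shuffle_cong_right) (rule d)
    also have "\<dots> = (\<Sum>n\<le>length w. q n w - q (Suc n) w)"
      by (subst c) (simp add: shuffle_sum_right shuffle_diff_left shuffle_one_left q_def
          sum_subtractf)
    also have "\<dots> = q 0 w - q (Suc (length w)) w"
      by (rule sum_telescope)
    also have "\<dots> = series_one w"
      using q_vanishes[of w "Suc (length w)"] by (simp add: q_def)
    finally show ?thesis .
  qed
  then have "shuffle d c = series_one"
    by (simp add: shuffle_commute[of d] fun_eq_iff)
  moreover have "d [] = 1"
    by (simp add: d_def q_def series_one_def)
  ultimately show ?thesis by blast
qed

lemma mult_G:
  "(c1, c2) \<otimes>\<^bsub>G\<^esub> (d1, d2) = (shuffle c1 d1, series_add c2 (shuffle d2 c1))"
  by (simp add: G_def)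

lemma one_G: "\<one>\<^bsub>G\<^esub> = (series_one, series_zero)"
  by (simp add: G_def)

lemma carrier_G: "(c1, c2) \<in> carrier G \<longleftrightarrow> c1 [] = 1"
  by (simp add: G_def)

lemma series_one_Nil: "series_one [] = 1"
  by (simp add: series_one_def)

lemma group_G: "group G"
proof (rule groupI)
  fix x y assume "x \<in> carrier G" "y \<in> carrier G"
  then show "x \<otimes>\<^bsub>G\<^esub> y \<in> carrier G"
    by (cases x; cases y) (simp add: mult_G carrier_G shuffle_Nil)
next
  show "\<one>\<^bsub>G\<^esub> \<in> carrier G"
    by (simp add: one_G carrier_G series_one_Nil)
next
  fix x y z :: "series \<times> series"
  obtain a1 a2 b1 b2 c1 c2 where xyz: "x = (a1, a2)" "y = (b1, b2)" "z = (c1, c2)"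
    by (metis surj_pair)
  have "shuffle c2 (shuffle a1 b1) = shuffle (shuffle c2 b1) a1"
    by (simp add: shuffle_assoc shuffle_commute[of a1])
  then show "x \<otimes>\<^bsub>G\<^esub> y \<otimes>\<^bsub>G\<^esub> z = x \<otimes>\<^bsub>G\<^esub> (y \<otimes>\<^bsub>G\<^esub> z)"
    unfolding xyz by (simp add: mult_G shuffle_assoc series_add_def shuffle_add_left add.assoc)
next
  fix x
  show "\<one>\<^bsub>G\<^esub> \<otimes>\<^bsub>G\<^esub> x = x"
    by (cases x)
      (simp add: one_G mult_G shuffle_one_left shuffle_one_right series_add_def series_zero_def)
next
  fix x assume "x \<in> carrier G"
  then obtain c1 c2 where x: "x = (c1, c2)" and "c1 [] = 1"
    by (cases x) (simp add: carrier_G)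
  then obtain d where d: "d [] = 1" "shuffle d c1 = series_one"
    using shuffle_inverse_exists by blast
  have "(d, \<lambda>w. - shuffle c2 d w) \<otimes>\<^bsub>G\<^esub> x = \<one>\<^bsub>G\<^esub>"
    by (simp add: x mult_G one_G d series_add_def series_zero_def)
  moreover have "(d, \<lambda>w. - shuffle c2 d w) \<in> carrier G"
    using d(1) by (simp add: carrier_G)
  ultimately show "\<exists>y\<in>carrier G. y \<otimes>\<^bsub>G\<^esub> x = \<one>\<^bsub>G\<^esub>"
    by blast
qed

lemma mult_G_plus:
  "(series_one, c) \<otimes>\<^bsub>G\<^esub> (series_one, d) = (series_one, series_add c d)"
  by (simp add: mult_G shuffle_one_right)

lemma inv_G_plus: "inv\<^bsub>G\<^esub> (series_one, d) = (series_one, \<lambda>w. - d w)"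
  by (rule group.inv_equality[OF group_G])
    (simp_all add: mult_G_plus one_G carrier_G series_one_Nil series_add_def series_zero_def)

lemma subgroup_G_plus: "subgroup G_plus G"
proof (rule group.subgroupI[OF group_G])
  show "G_plus \<subseteq> carrier G"
    by (auto simp: G_plus_def carrier_G series_one_Nil)
qed (auto simp: G_plus_def inv_G_plus mult_G_plus)

lemma comm_group_G_plus: "comm_group (G\<lparr>carrier := G_plus\<rparr>)"
proof (rule group.group_comm_groupI)
  show "group (G\<lparr>carrier := G_plus\<rparr>)"
    using group.subgroup_imp_group[OF group_G subgroup_G_plus] .
qed (auto simp: G_plus_def mult_G_plus series_add_def add.commute)

lemma commutators_subset: "commutators \<subseteq> G_plus"
proof
  fix z assume "z \<in> commutators"
  then obtain c d where c: "c [] = 1"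
    and z: "z = (c, series_zero) \<otimes>\<^bsub>G\<^esub> (series_one, d) \<otimes>\<^bsub>G\<^esub> inv\<^bsub>G\<^esub> (c, series_zero)
                  \<otimes>\<^bsub>G\<^esub> inv\<^bsub>G\<^esub> (series_one, d)"
    unfolding commutators_def M_def G_plus_def by blast
  obtain c' e where inv: "inv\<^bsub>G\<^esub> (c, series_zero) = (c', e)"
    by (metis surj_pair)
  have "(c, series_zero) \<otimes>\<^bsub>G\<^esub> (c', e) = \<one>\<^bsub>G\<^esub>"
    using group.r_inv[OF group_G] c by (simp add: carrier_G flip: inv)
  then have "shuffle c c' = series_one"
    by (simp add: mult_G one_G)
  then show "z \<in> G_plus"
    by (simp add: z inv inv_G_plus mult_G shuffle_one_right G_plus_def)
qed

theorem theorem4p13: "generate G commutators \<lhd> G\<lparr>carrier := G_plus\<rparr>"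
proof -
  interpret G: group G
    by (rule group_G)
  have "commutators \<subseteq> carrier G"
    using commutators_subset subgroup.subset[OF subgroup_G_plus] by blast
  then have "subgroup (generate G commutators) G"
    by (rule G.generate_is_subgroup)
  moreover have "generate G commutators \<subseteq> G_plus"
    by (rule G.generate_subgroup_incl[OF commutators_subset subgroup_G_plus])
  ultimately have "subgroup (generate G commutators) (G\<lparr>carrier := G_plus\<rparr>)"
    using G.subgroup_incl subgroup_G_plus by blast
  then show ?thesis
    by (rule comm_group.normal_iff_subgroup[OF comm_group_G_plus, THEN iffD2])
qed

end
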